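(* Let $\mathcal G$ be a finite connected graph with Kirchhoff conditions at interior vertices and a fixed Dirichlet or Neumann condition at each exterior vertex, with secular unitary $U_B(\theta)$ and secular set $Z_B\subset\mathbb T^{\mathcal E}$. Let $\ell\in(0,\infty)^{\mathcal E}$, and let $\theta^\star\in Z_B$ be a point at which $1$ is a simple eigenvalue of $U_B(\theta^\star)$; let $\varphi$ be the smooth local eigenphase near $\theta^\star$ with $\varphi(\theta^\star)=0$, and suppose $D_\ell\varphi(\theta^\star):=\ell\cdot\nabla\varphi(\theta^\star)\ne0$. Then the following are equivalent: (i) $\theta^\star\in H_\ell$; (ii) there exist $k_n\to\infty$ such that $[k_n\ell]\in Z_B$ for all $n$ and $[k_n\ell]\to\theta^\star$.
   Context: $\mathcal G$ is a finite connected graph with edge set $\mathcal E$ (loops and parallel edges allowed); a vertex is exterior if it has degree one (loops count twice), interior otherwise. $\mathbb T=\mathbb R/2\pi\mathbb Z$, and $[x]$ denotes the class of $x\in\mathbb R^{\mathcal E}$ in $\mathbb T^{\mathcal E}$. Let $\mathcal B$ be the set of directed bonds (each edge $e$ gives two, reverses of each other). Let $S_B$ be the unitary matrix on $\mathbb C^{\mathcal B}$ with $(S_Ba)_b=\sum_{b'}\sigma_{bb'}a_{b'}$, the sum over bonds $b'$ ending at the initial vertex $v$ of $b$; if $v$ is interior of degree $d$, $\sigma_{bb'}=2/d-1$ if $b'$ is the reverse of $b$ and $2/d$ otherwise; if $v$ is exterior, $\sigma_{bb'}=-1$ (Dirichlet) or $+1$ (Neumann). For $\theta\in\mathbb T^{\mathcal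 E}$, $D(\theta)$ is the diagonal matrix with entry $e^{i\theta_e}$ on both bonds of $e$, $U_B(\theta)=D(\theta)S_B$, and $Z_B=\{\theta\in\mathbb T^{\mathcal E}:\det(I-U_B(\theta))=0\}$. If $1$ is a simple eigenvalue of $U_B(\theta^\star)$, then near $\theta^\star$ there are a smooth normalized eigenvector $a(\theta)$ and a smooth real eigenphase $\varphi(\theta)$ with $U_B(\theta)a(\theta)=e^{i\varphi(\theta)}a(\theta)$, $\varphi(\theta^\star)=0$. $H_\ell=\overline{\{[k\ell]:k\in\mathbb R\}}\subset\mathbb T^{\mathcal E}$. *)

theory Defs
  imports
    "HOL-Analysis.Analysis"
    "HOL-Library.Real_Mod"
    "HOL-Computational_Algebra.Polynomial"
    "Graph_Theory.Digraph_Component"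
begin

section \<open>The torus\<close>

text \<open>The circle \<open>\<real>/2\<pi>\<int>\<close>, with its quotient group structure and its quotient topology. The torus
  is \<open>circle ^ 'e\<close>, whose group structure and (product) topology are those that the library
  provides for finite Cartesian products.\<close>

quotient_type circle = real / "\<lambda>x y. [x = y] (rmod (2 * pi))"
  morphisms rep_circle circle_class
  by (rule equivpI) (auto simp: reflp_def symp_def transp_def rcong_def)

instantiation circle :: ab_group_add
begin

lift_definition zero_circle :: circle is 0 .
lift_definition plus_circle :: "circle \<Rightarrow> circle \<Rightarrow> circle" is "(+)" by (rule rcong_add)
lift_definition uminus_circle :: "circle \<Rightarrow> circle" is uminus by (rule rcong_uminus)
lift_definition minus_circle :: "circle \<Rightarrow> circle \<Rightarrow> circle" is "(-)" by (rule rcong_diff)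

instance
  by standard (transfer; simp add: algebra_simps)+

end

instantiation circle :: topological_space
begin

definition open_circle :: "circle set \<Rightarrow> bool" where
  "open_circle A \<longleftrightarrow> open (circle_class -` A)"

instance
  by standard (auto simp: open_circle_def vimage_Union intro!: open_Int open_UN)

end

lift_definition circle_cis :: "circle \<Rightarrow> complex" is cis
proof -
  fix x y :: real
  assume "[x = y] (rmod (2 * pi))"
  then obtain n :: int where "y = x + 2 * pi * of_int n"
    by (auto simp: rcong_altdef mult_ac)
  then show "cis x = cis y"
    by (simp flip: cis_mult)
qed

definition torus_class :: "real ^ 'e \<Rightarrow> circle ^ 'e" where
  "torus_class x = (\<chi> e. circle_class (x $ e))"


section \<open>Smooth functions and gradients on the torus\<close>

text \<open>On an open set \<open>A\<close> of a Euclidean space, \<open>Ck_on n A f\<close> says that \<open>f\<close> is \<open>n\<close> times continuously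
  differentiable. The derivative is passed to the recursive call in the form of all the
  directional derivatives, so that the type of \<open>f\<close> does not change.\<close>

primrec Ck_on :: "nat \<Rightarrow> 'a::real_normed_vector set \<Rightarrow> ('a \<Rightarrow> 'b::real_normed_vector) \<Rightarrow> bool" where
  "Ck_on 0 A f \<longleftrightarrow> continuous_on A f"
| "Ck_on (Suc n) A f \<longleftrightarrow> (\<forall>x\<in>A. f differentiable (at x)) \<and>
     (\<forall>v. Ck_on n A (\<lambda>x. frechet_derivative f (at x) v))"

text \<open>The class map is a local diffeomorphism, so smoothness on an open subset of the torus is
  smoothness of the periodic lift.\<close>

definition torus_smooth_on ::
    "(circle ^ 'e) set \<Rightarrow> (circle ^ 'e \<Rightarrow> 'b::real_normed_vector) \<Rightarrow> bool" where
  "torus_smooth_on N f \<longleftrightarrow> (\<forall>n. Ck_on n (torus_class -` N) (\<lambda>x. f (torus_class x)))"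

definition torus_gradient :: "(circle ^ 'e \<Rightarrow> real) \<Rightarrow> circle ^ 'e \<Rightarrow> real ^ 'e" where
  "torus_gradient f \<theta> = (\<chi> e. deriv (\<lambda>t. f (\<theta> + torus_class (axis e t))) 0)"


section \<open>The bond scattering matrix and the secular set\<close>

text \<open>A multigraph is given as a directed multigraph \<open>G\<close> with arc set \<open>UNIV :: 'e set\<close>: every edge
  carries an arbitrary reference orientation. The bond \<open>(e, True)\<close> runs along \<open>e\<close> in this
  orientation, and \<open>(e, False)\<close> runs against it.\<close>

type_synonym 'e bond = "'e \<times> bool"

definition bond_reverse :: "'e bond \<Rightarrow> 'e bond" where
  "bond_reverse b = (fst b, \<not> snd b)"

definition bond_initial :: "('v, 'e) pre_digraph \<Rightarrow> 'e bond \<Rightarrow> 'v" where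
  "bond_initial G b = (if snd b then tail G (fst b) else head G (fst b))"

definition bond_terminal :: "('v, 'e) pre_digraph \<Rightarrow> 'e bond \<Rightarrow> 'v" where
  "bond_terminal G b = bond_initial G (bond_reverse b)"

definition vertex_degree :: "('v, 'e) pre_digraph \<Rightarrow> 'v \<Rightarrow> nat" where
  "vertex_degree G v = in_degree G v + out_degree G v"

definition exterior_vertex :: "('v, 'e) pre_digraph \<Rightarrow> 'v \<Rightarrow> bool" where
  "exterior_vertex G v \<longleftrightarrow> vertex_degree G v = 1"

datatype exterior_condition = Dirichlet | Neumann

text \<open>The boundary condition \<open>bc v\<close> is relevant only if \<open>v\<close> is exterior; the conditions at interior
  vertices are always the Kirchhoff conditions.\<close>

definition scattering_coefficient ::
    "('v, 'e) pre_digraph \<Rightarrow> ('v \<Rightarrow> exterior_condition) \<Rightarrow> 'e bond \<Rightarrow> 'e bond \<Rightarrow> complex" where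
  "scattering_coefficient G bc b b' =
    (let v = bond_initial G b; d = of_nat (vertex_degree G v) in
      if exterior_vertex G v then (case bc v of Dirichlet \<Rightarrow> - 1 | Neumann \<Rightarrow> 1)
      else if b' = bond_reverse b then 2 / d - 1
      else 2 / d)"

definition bond_scattering_matrix ::
    "('v, 'e::finite) pre_digraph \<Rightarrow> ('v \<Rightarrow> exterior_condition) \<Rightarrow>
      complex ^ 'e bond ^ 'e bond" where
  "bond_scattering_matrix G bc =
    (\<chi> b b'. if bond_terminal G b' = bond_initial G b
            then scattering_coefficient G bc b b' else 0)"

definition phase_matrix :: "circle ^ 'e \<Rightarrow> complex ^ ('e::finite) bond ^ 'e bond" where
  "phase_matrix \<theta> = (\<chi> b b'. if b = b' then circle_cis (\<theta> $ fst b) else 0)"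

definition secular_unitary ::
    "('v, 'e::finite) pre_digraph \<Rightarrow> ('v \<Rightarrow> exterior_condition) \<Rightarrow> circle ^ 'e \<Rightarrow>
      complex ^ 'e bond ^ 'e bond" where
  "secular_unitary G bc \<theta> = phase_matrix \<theta> ** bond_scattering_matrix G bc"

definition secular_set ::
    "('v, 'e::finite) pre_digraph \<Rightarrow> ('v \<Rightarrow> exterior_condition) \<Rightarrow> (circle ^ 'e) set" where
  "secular_set G bc = {\<theta>. det (mat 1 - secular_unitary G bc \<theta>) = 0}"


section \<open>Simple eigenvalues and the local eigenphase\<close>

definition characteristic_poly :: "complex ^ 'n ^ 'n \<Rightarrow> complex poly" where
  "characteristic_poly A = det (mat [:0, 1:] - map_matrix (\<lambda>z. [:z:]) A)"

definition simple_eigenvalue :: "complex ^ 'n ^ 'n \<Rightarrow> complex \<Rightarrow> bool" where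
  "simple_eigenvalue A z \<longleftrightarrow> order z (characteristic_poly A) = 1"

definition local_eigenphase ::
    "('v, 'e::finite) pre_digraph \<Rightarrow> ('v \<Rightarrow> exterior_condition) \<Rightarrow> circle ^ 'e \<Rightarrow>
      (circle ^ 'e \<Rightarrow> real) \<Rightarrow> bool" where
  "local_eigenphase G bc \<theta>\<^sub>0 \<phi> \<longleftrightarrow> \<phi> \<theta>\<^sub>0 = 0 \<and>
    (\<exists>N (a :: circle ^ 'e \<Rightarrow> complex ^ 'e bond).
      open N \<and> \<theta>\<^sub>0 \<in> N \<and> torus_smooth_on N a \<and> torus_smooth_on N \<phi> \<and>
      (\<forall>\<theta>\<in>N. norm (a \<theta>) = 1 \<and>
        secular_unitary G bc \<theta> *v a \<theta> = cis (\<phi> \<theta>) *s a \<theta>))"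


section \<open>The orbit closure of a linear flow\<close>

definition flow_closure :: "real ^ 'e \<Rightarrow> (circle ^ 'e) set" where
  "flow_closure l = closure (range (\<lambda>k::real. torus_class (k *\<^sub>R l)))"

end

theory Submission
  imports Defs
begin

text \<open>
  Since the torus is compact, the flow returns arbitrarily close to \<open>0\<close> at arbitrarily late times, so
  a point of the orbit closure is approached along times tending to infinity. Near \<open>\<theta>\<close> the eigenphase
  is strictly monotone to first order along \<open>l\<close>, hence changes sign on a short flow segment through
  every point close to \<open>\<theta>\<close>, and the intermediate value theorem moves each of these times slightly
  so that the flow hits the zero set of the eigenphase, which lies in the secular set.
\<close>

section \<open>Topology of the class map from Euclidean space to the torus\<close>

lemma circle_class_eq_iff:
  "circle_class x = circle_class y \<longleftrightarrow> [x = y] (rmod (2 * pi))"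
  by transfer simp

lemma circle_class_rmod: "circle_class (x rmod (2 * pi)) = circle_class x"
  by (simp add: circle_class_eq_iff rcong_def)

lemma continuous_circle_class: "continuous_on UNIV circle_class"
  by (simp add: continuous_on_open_vimage open_circle_def)

text \<open>In the quotient topology one has to look at the preimage of the image, and this is the
  union of the translates of \<open>U\<close> by all multiples of 2 pi, each of them open.\<close>

lemma open_circle_class_image:
  assumes "open U"
  shows "open (circle_class ` U)"
proof -
  have "circle_class -` circle_class ` U = (\<Union>n::int. (\<lambda>x. 2 * pi * of_int n + x) ` U)"
    (is "?L = ?R")
  proof
    show "?L \<subseteq> ?R"
    proof
      fix y
      assume "y \<in> ?L"
      then obtain x where "x \<in> U" "[x = y] (rmod (2 * pi))"
        by (auto simp: circle_class_eq_iff rcong_sym_iff)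
      then show "y \<in> ?R"
        by (auto simp: rcong_altdef mult_ac image_iff add.commute)
    qed
    have "circle_class (2 * pi * of_int n + x) = circle_class x" for n :: int and x
      by (subst eq_commute) (auto simp: circle_class_eq_iff rcong_altdef)
    then show "?R \<subseteq> ?L"
      by auto
  qed
  moreover have "open ((\<lambda>x. 2 * pi * of_int n + x) ` U)" for n :: int
    using assms by (rule open_translation)
  ultimately show ?thesis
    by (auto simp: open_circle_def)
qed

lemma torus_class_nth [simp]: "torus_class x $ e = circle_class (x $ e)"
  by (simp add: torus_class_def)

lemma torus_class_add: "torus_class (x + y) = torus_class x + torus_class y"
  by (simp add: vec_eq_iff plus_circle.abs_eq)

lemma torus_class_diff: "torus_class (x - y) = torus_class x - torus_class y"
  by (simp add: vec_eq_iff minus_circle.abs_eq)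

lemma torus_class_surj: "\<exists>x. torus_class x = \<theta>"
proof
  show "torus_class (\<chi> e. rep_circle (\<theta> $ e)) = \<theta>"
    using Quotient3_abs_rep[OF Quotient3_circle] by (simp add: vec_eq_iff)
qed

lemma continuous_torus_class: "continuous_on UNIV torus_class"
  unfolding torus_class_def
  by (intro continuous_on_vec_lambda continuous_on_compose2[OF continuous_circle_class]
      continuous_intros) auto

text \<open>Lifts nearness on the torus to nearness in \<open>real ^ 'e\<close>. The class map is
  open, so a small neighbourhood of \<open>x\<close> covers a neighbourhood of its class, and that
  one meets \<open>S\<close>.\<close>

lemma closure_torus_class_imageE:
  fixes x :: "real ^ 'e"
  assumes "torus_class x \<in> closure S" "\<epsilon> > 0"
  obtains y where "torus_class y \<in> S" "dist y x < \<epsilon>"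
proof -
  obtain B where B: "\<And>e. open (B e)" "\<And>e. x $ e \<in> B e"
    "\<And>y. (\<forall>e. y $ e \<in> B e) \<Longrightarrow> y \<in> ball x \<epsilon>"
    using open_ball[of x \<epsilon>] assms(2) unfolding open_vec_def
    by (metis centre_in_ball)
  define V where "V = {\<xi> :: circle ^ 'e. \<forall>e. \<xi> $ e \<in> circle_class ` B e}"
  have "open V"
    unfolding V_def open_vec_def using open_circle_class_image[OF B(1)]
    by (intro ballI exI[of _ "\<lambda>e. circle_class ` B e"]) auto
  moreover have "torus_class x \<in> V"
    using B(2) by (auto simp: V_def)
  ultimately obtain \<xi> where \<xi>: "\<xi> \<in> S" "\<xi> \<in> V"
    using assms(1) by (meson closure_iff_nhds_not_empty disjoint_iff order_refl)
  then have "\<forall>e. \<exists>t. t \<in> B e \<and> \<xi> $ e = circle_class t"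
    by (auto simp: V_def)
  then obtain f where f: "\<And>e. f e \<in> B e" "\<And>e. \<xi> $ e = circle_class (f e)"
    by metis
  show ?thesis
  proof
    have "torus_class (\<chi> e. f e) = \<xi>"
      using f by (simp add: vec_eq_iff)
    then show "torus_class (\<chi> e. f e) \<in> S"
      using \<xi> by simp
    show "dist (\<chi> e. f e) x < \<epsilon>"
      using B(3)[of "\<chi> e. f e"] f by (simp add: dist_commute)
  qed
qed

section \<open>Recurrence of the linear flow\<close>

text \<open>Pigeonhole by compactness: the representatives of the flow at the times
  \<open>n * K'\<close> lie in a cube of side 2 pi, so a subsequence is Cauchy. The difference of
  two of its late times is a return time, and the difference of the representatives is the small
  vector \<open>z\<close>.\<close>

lemma torus_flow_recurrent:
  fixes l :: "real ^ 'e"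
  assumes "\<epsilon> > 0"
  obtains t z where "t \<ge> K" "torus_class (t *\<^sub>R l) = torus_class z" "norm z < \<epsilon>"
proof -
  \<comment> \<open>Sampling with step \<open>K'\<close> puts distinct samples at least
    \<open>K'\<close> apart in time, and \<open>K' \<ge> K\<close>. The maximum with 1 makes the
    step positive for every \<open>K\<close>.\<close>
  define K' where "K' = max K 1"
  define r where "r n = (\<chi> e. (real n * K' * l $ e) rmod (2 * pi))" for n
  have r: "torus_class (r n) = torus_class ((real n * K') *\<^sub>R l)" for n
    by (simp add: vec_eq_iff r_def circle_class_rmod)
  have "r n \<in> cbox 0 (\<chi> e. 2 * pi)" for n
    using rmod_nonneg[of "2 * pi"] rmod_less[of "2 * pi"]
    by (auto simp: mem_box_cart r_def less_imp_le)
  then obtain q s where s: "strict_mono (s :: nat \<Rightarrow> nat)" "(r \<circ> s) \<longlonglongrightarrow> q"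
    using compact_cbox[of "0 :: real ^ 'e" "\<chi> e. 2 * pi"] unfolding compact_def by metis
  then have "Cauchy (r \<circ> s)"
    by (simp add: LIMSEQ_imp_Cauchy)
  then obtain M where M: "\<And>m n. m \<ge> M \<Longrightarrow> n \<ge> M \<Longrightarrow> dist (r (s m)) (r (s n)) < \<epsilon>"
    using assms unfolding Cauchy_def comp_def by metis
  define d where "d = real (s (Suc M)) - real (s M)"
  have "s M < s (Suc M)"
    using s(1) by (simp add: strict_mono_def)
  then have "d \<ge> 1"
    unfolding d_def by linarith
  show ?thesis
  proof
    have "1 * K' \<le> d * K'"
      using \<open>d \<ge> 1\<close> by (intro mult_right_mono) (auto simp: K'_def)
    then show "K \<le> d * K'"
      by (simp add: K'_def)
    have "(d * K') *\<^sub>R l = (real (s (Suc M)) * K') *\<^sub>R l - (real (s M) * K') *\<^sub>R l"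
      by (simp add: d_def algebra_simps)
    then show "torus_class ((d * K') *\<^sub>R l) = torus_class (r (s (Suc M)) - r (s M))"
      by (simp only: torus_class_diff r)
    show "norm (r (s (Suc M)) - r (s M)) < \<epsilon>"
      using M[of "Suc M" M] by (simp add: dist_norm)
  qed
qed

text \<open>Membership in the closure gives some time \<open>k\<close> of arbitrary sign and size.
  Adding a return time of at least \<open>K - k\<close> makes it late, and the two errors, each
  below half of \<epsilon>, add up in the lift.\<close>

lemma flow_closure_late_times:
  fixes l x :: "real ^ 'e"
  assumes "torus_class x \<in> flow_closure l" "\<epsilon> > 0"
  obtains k y where "k \<ge> K" "torus_class (k *\<^sub>R l) = torus_class y" "dist y x < \<epsilon>"
proof -
  obtain y where "torus_class y \<in> range (\<lambda>k. torus_class (k *\<^sub>R l))" and y: "dist y x < \<epsilon> / 2"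
    using closure_torus_class_imageE[of x _ "\<epsilon> / 2"] assms unfolding flow_closure_def by auto
  then obtain k where k: "torus_class y = torus_class (k *\<^sub>R l)"
    by auto
  obtain t z where t: "t \<ge> K - k" "torus_class (t *\<^sub>R l) = torus_class z" "norm z < \<epsilon> / 2"
    using torus_flow_recurrent[of "\<epsilon> / 2" "K - k" l] assms(2) by auto
  show ?thesis
  proof
    show "k + t \<ge> K"
      using t(1) by simp
    show "torus_class ((k + t) *\<^sub>R l) = torus_class (y + z)"
      using k t(2) by (simp add: scaleR_left_distrib torus_class_add)
    have "dist (y + z) x \<le> dist y x + norm z"
      using norm_triangle_ineq[of "y - x" z] by (simp only: dist_norm add_diff_eq diff_add_eq)
    then show "dist (y + z) x < \<epsilon>"
      using y t(3) by linarith
  qed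
qed

section \<open>Zeros on flow segments close to a transversal zero\<close>

text \<open>The difference quotients at \<open>t\<close> and \<open>- t\<close> both tend to
  \<open>c\<close>, so their product tends to \<open>c * c > 0\<close>. That product equals
  \<open>- (h t * h (- t)) / (t * t)\<close>.\<close>

lemma sign_change_of_deriv_nonzero:
  fixes h :: "real \<Rightarrow> real"
  assumes "(h has_real_derivative c) (at 0)" "h 0 = 0" "c \<noteq> 0"
  shows "eventually (\<lambda>t. h t * h (- t) < 0) (at_right 0)"
proof -
  have lim: "((\<lambda>t. h t / t) \<longlongrightarrow> c) (at 0)"
    using assms(1,2) by (simp add: has_field_derivative_iff)
  have R: "((\<lambda>t. h t / t) \<longlongrightarrow> c) (at_right 0)"
    using lim by (rule filterlim_mono) (auto simp: at_within_le_at)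
  have L: "((\<lambda>t. h (- t) / (- t)) \<longlongrightarrow> c) (at_right 0)"
    using lim unfolding filterlim_at_split by (simp add: filterlim_at_left_to_right)
  have "((\<lambda>t. (h t / t) * (h (- t) / (- t))) \<longlongrightarrow> c * c) (at_right 0)"
    by (rule tendsto_mult[OF R L])
  moreover have "c * c > 0"
    using assms(3) by (metis not_real_square_gt_zero)
  ultimately have "eventually (\<lambda>t. (h t / t) * (h (- t) / (- t)) > 0) (at_right 0)"
    by (rule order_tendstoD)
  moreover have "eventually (\<lambda>t::real. t > 0) (at_right 0)"
    by (simp add: eventually_at_right_less)
  ultimately show ?thesis
  proof eventually_elim
    case (elim t)
    then have "h t * h (- t) / (t * t) < 0"
      by simp
    then show ?case
      using elim(2) by (simp add: divide_less_0_iff mult_less_0_iff)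
  qed
qed

text \<open>The derivative enters only on the line through \<open>x\<close>, where it yields one
  fixed \<open>t\<close> with opposite signs at the times \<open>t\<close> and \<open>- t\<close>.
  Continuity of \<open>g\<close> carries these two signs over to all starting points
  \<open>y\<close> near \<open>x\<close>, and the intermediate value theorem then applies on each
  segment.\<close>

lemma zero_on_nearby_flow_lines:
  fixes g :: "'a::real_normed_vector \<Rightarrow> real"
  assumes "open W" "x \<in> W" "continuous_on W g" "g x = 0"
    and "((\<lambda>t. g (x + t *\<^sub>R l)) has_real_derivative c) (at 0)" "c \<noteq> 0" "\<epsilon> > 0"
  obtains \<delta> where "\<delta> > 0"
    "\<And>y. dist y x < \<delta> \<Longrightarrow> \<exists>s. \<bar>s\<bar> \<le> \<epsilon> \<and> dist (y + s *\<^sub>R l) x < \<epsilon> \<and> y + s *\<^sub>R l \<in> W \<and> g (y + s *\<^sub>R l) = 0"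
proof -
  obtain \<rho> where \<rho>: "\<rho> > 0" "ball x \<rho> \<subseteq> W"
    using assms(1,2) openE by blast
  define \<eta> where "\<eta> = min \<rho> \<epsilon>"
  have "\<eta> > 0"
    using \<rho> assms(7) by (simp add: \<eta>_def)
  have "eventually (\<lambda>t. g (x + t *\<^sub>R l) * g (x + (- t) *\<^sub>R l) < 0) (at_right 0)"
    using sign_change_of_deriv_nonzero[OF assms(5)] assms(4,6) by simp
  \<comment> \<open>The second bound forces \<open>t * norm l < \<eta> / 2\<close>, so segments
    starting within \<open>\<eta> / 2\<close> of \<open>x\<close> stay within \<eta> of it. The
    summand 1 keeps the denominator positive without a case split on \<open>l\<close>.\<close>
  moreover have "eventually (\<lambda>t. t < min \<epsilon> (\<eta> / (2 * (norm l + 1)))) (at_right (0::real))"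
    using assms(7) \<open>\<eta> > 0\<close> by (intro order_tendstoD(2)[OF tendsto_ident_at])
      (simp add: add_nonneg_pos)
  moreover have "eventually (\<lambda>t::real. t > 0) (at_right 0)"
    by (simp add: eventually_at_right_less)
  ultimately have "eventually (\<lambda>t. g (x + t *\<^sub>R l) * g (x + (- t) *\<^sub>R l) < 0 \<and>
      t < min \<epsilon> (\<eta> / (2 * (norm l + 1))) \<and> t > 0) (at_right 0)"
    by eventually_elim auto
  then obtain t where sgn: "g (x + t *\<^sub>R l) * g (x + (- t) *\<^sub>R l) < 0"
    and t: "t > 0" "t < \<epsilon>" "t < \<eta> / (2 * (norm l + 1))"
    using eventually_happens'[OF trivial_limit_at_right_real] by (metis (lifting) min_less_iff_conj)
  have tl: "t * norm l < \<eta> / 2"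
  proof -
    have "norm l + 1 > 0"
      using norm_ge_zero[of l] by linarith
    then have "t * (norm l + 1) < \<eta> / 2"
      using t(3) by (simp add: field_simps)
    then show ?thesis
      using t(1) by (simp add: algebra_simps)
  qed
  have near: "dist (y + s *\<^sub>R l) x < \<eta>" if "dist y x < \<eta> / 2" "\<bar>s\<bar> \<le> t" for y s
  proof -
    have "dist (y + s *\<^sub>R l) x \<le> dist y x + norm (s *\<^sub>R l)"
      using norm_triangle_ineq[of "y - x" "s *\<^sub>R l"] by (simp only: dist_norm add_diff_eq diff_add_eq)
    also have "norm (s *\<^sub>R l) \<le> t * norm l"
      using that(2) by (simp add: mult_right_mono)
    finally show ?thesis
      using that(1) tl by linarith
  qed
  have inW: "y + s *\<^sub>R l \<in> W" if "dist y x < \<eta> / 2" "\<bar>s\<bar> \<le> t" for y s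
    using near[OF that] \<rho>(2) by (auto simp: \<eta>_def dist_commute subset_iff)
  have cont: "((\<lambda>y. g (y + s *\<^sub>R l)) \<longlongrightarrow> g (x + s *\<^sub>R l)) (nhds x)" if "\<bar>s\<bar> \<le> t" for s
  proof -
    have "isCont g (x + s *\<^sub>R l)"
      using inW[of x s] that \<open>\<eta> > 0\<close> assms(1,3) by (simp add: continuous_on_eq_continuous_at)
    moreover have "((\<lambda>y. y + s *\<^sub>R l) \<longlongrightarrow> x + s *\<^sub>R l) (nhds x)"
      by (intro tendsto_add tendsto_const filterlim_ident)
    ultimately show ?thesis
      by (rule isCont_tendsto_compose)
  qed
  \<comment> \<open>With \<open>t\<close> fixed, the product of the two endpoint values is
    continuous in the starting point at \<open>x\<close>, so its negativity persists on a ball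
    around \<open>x\<close>.\<close>
  have "((\<lambda>y. g (y + t *\<^sub>R l) * g (y + (- t) *\<^sub>R l)) \<longlongrightarrow> g (x + t *\<^sub>R l) * g (x + (- t) *\<^sub>R l)) (nhds x)"
    using t(1) by (intro tendsto_mult cont) auto
  then have "eventually (\<lambda>y. g (y + t *\<^sub>R l) * g (y + (- t) *\<^sub>R l) < 0) (nhds x)"
    using sgn by (rule order_tendstoD)
  then obtain \<delta> where \<delta>: "\<delta> > 0"
    "\<And>y. dist y x < \<delta> \<Longrightarrow> g (y + t *\<^sub>R l) * g (y + (- t) *\<^sub>R l) < 0"
    unfolding eventually_nhds_metric by auto
  show ?thesis
  proof
    show "min \<delta> (\<eta> / 2) > 0"
      using \<delta>(1) \<open>\<eta> > 0\<close> by simp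
    fix y
    assume y: "dist y x < min \<delta> (\<eta> / 2)"
    have "continuous_on {-t..t} (\<lambda>s. g (y + s *\<^sub>R l))"
      using inW y by (intro continuous_on_compose2[OF assms(3)] continuous_intros) auto
    \<comment> \<open>The sign of \<open>c\<close> is not fixed, so both orders of the endpoint
      signs occur: \<open>IVT'\<close> serves the first, \<open>IVT2'\<close> the second.\<close>
    moreover have "g (y + (- t) *\<^sub>R l) \<le> 0 \<and> 0 \<le> g (y + t *\<^sub>R l) \<or>
        g (y + t *\<^sub>R l) \<le> 0 \<and> 0 \<le> g (y + (- t) *\<^sub>R l)"
      using \<delta>(2)[of y] y by (auto simp: mult_less_0_iff)
    ultimately have "\<exists>s. -t \<le> s \<and> s \<le> t \<and> g (y + s *\<^sub>R l) = 0"
      using t(1) IVT'[of "\<lambda>s. g (y + s *\<^sub>R l)" "-t" 0 t]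
        IVT2'[of "\<lambda>s. g (y + s *\<^sub>R l)" t 0 "-t"] by (elim disjE conjE) simp_all
    then obtain s where s: "-t \<le> s" "s \<le> t" "g (y + s *\<^sub>R l) = 0"
      by blast
    then have "\<bar>s\<bar> \<le> t"
      by simp
    then show "\<exists>s. \<bar>s\<bar> \<le> \<epsilon> \<and> dist (y + s *\<^sub>R l) x < \<epsilon> \<and> y + s *\<^sub>R l \<in> W \<and> g (y + s *\<^sub>R l) = 0"
      using s near[of y s] inW[of y s] y t(2) by (intro exI[of _ s]) (auto simp: \<eta>_def)
  qed
qed

section \<open>The torus gradient as the derivative of the lift\<close>

text \<open>Since the class map is additive, the components of \<open>torus_gradient\<close> are the
  partial derivatives of the lift. Linearity of its Frechet derivative \<open>D\<close> assembles
  them into the derivative along \<open>l\<close>.\<close>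

lemma torus_gradient_directional_deriv:
  fixes l x :: "real ^ 'e::finite"
  assumes "(\<lambda>x. \<phi> (torus_class x)) differentiable (at x)"
  shows "((\<lambda>t. \<phi> (torus_class (x + t *\<^sub>R l))) has_real_derivative
    l \<bullet> torus_gradient \<phi> (torus_class x)) (at 0)"
proof -
  define g where "g x = \<phi> (torus_class x)" for x
  obtain D where D: "(g has_derivative D) (at x)"
    using assms unfolding differentiable_def g_def[abs_def] by auto
  have lin: "linear D"
    using D by (rule has_derivative_linear)
  have dir: "((\<lambda>t. g (x + t *\<^sub>R v)) has_real_derivative D v) (at 0)" for v
  proof -
    have "((\<lambda>t. x + t *\<^sub>R v) has_derivative (\<lambda>t. t *\<^sub>R v)) (at 0)"
      by (auto intro!: derivative_eq_intros)
    then have "((\<lambda>t. g (x + t *\<^sub>R v)) has_derivative (\<lambda>t. D (t *\<^sub>R v))) (at 0)"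
      by (rule has_derivative_compose) (use D in simp)
    then show ?thesis
      by (simp add: has_field_derivative_def linear_scale[OF lin] mult.commute[of _ "D v"])
  qed
  have "torus_gradient \<phi> (torus_class x) $ e = D (axis e 1)" for e
  proof -
    have "torus_gradient \<phi> (torus_class x) $ e = deriv (\<lambda>t. g (x + axis e t)) 0"
      by (simp add: torus_gradient_def g_def torus_class_add)
    also have "(\<lambda>t. g (x + axis e t)) = (\<lambda>t. g (x + t *\<^sub>R axis e 1))"
      by (intro ext arg_cong[of _ _ g]) (simp add: vec_eq_iff axis_def)
    also have "deriv \<dots> 0 = D (axis e 1)"
      by (rule DERIV_imp_deriv[OF dir])
    finally show ?thesis .
  qed
  then have "l \<bullet> torus_gradient \<phi> (torus_class x) = (\<Sum>e\<in>UNIV. l $ e * D (axis e 1))"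
    by (simp add: inner_vec_def)
  also have "\<dots> = D (\<Sum>e\<in>UNIV. l $ e *\<^sub>R axis e 1)"
    by (simp add: linear_sum[OF lin] linear_scale[OF lin])
  also have "(\<Sum>e\<in>UNIV. l $ e *\<^sub>R axis e 1) = l"
    using basis_expansion[of l] by (simp add: scalar_mult_eq_scaleR)
  finally show ?thesis
    using dir[of l] by (simp add: g_def)
qed

section \<open>Fixed vectors of the secular unitary and the secular set\<close>

lemma det_eq_0_of_kernel:
  fixes A :: "'a::field ^ 'n ^ 'n"
  assumes "A *v v = 0" "v \<noteq> 0"
  shows "det A = 0"
proof (rule ccontr)
  assume "det A \<noteq> 0"
  then obtain B where "B ** A = mat 1"
    using invertible_det_nz[of A] by (auto simp: invertible_def)
  then have "v = B *v (A *v v)"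
    by (simp add: matrix_vector_mul_assoc)
  then show False
    using assms by simp
qed

lemma secular_set_of_eigenvector:
  assumes "secular_unitary G bc \<theta> *v a = a" "a \<noteq> 0"
  shows "\<theta> \<in> secular_set G bc"
  using det_eq_0_of_kernel[of "mat 1 - secular_unitary G bc \<theta>" a] assms
  by (simp add: secular_set_def matrix_vector_mult_diff_rdistrib)

section \<open>Equivalence of orbit closure and approach along secular times\<close>

theorem theorem5p6:
  fixes G :: "('v, 'e::finite) pre_digraph"
    and bc :: "'v \<Rightarrow> exterior_condition"
    and l :: "real ^ 'e"
    and \<theta> :: "circle ^ 'e"
    and \<phi> :: "circle ^ 'e \<Rightarrow> real"
  assumes "fin_digraph G" and "arcs G = UNIV" and "Digraph_Component.connected G"
    and "\<And>e. l $ e > 0"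
    and "\<theta> \<in> secular_set G bc"
    and "simple_eigenvalue (secular_unitary G bc \<theta>) 1"
    and "local_eigenphase G bc \<theta> \<phi>"
    and "l \<bullet> torus_gradient \<phi> \<theta> \<noteq> 0"
  shows "\<theta> \<in> flow_closure l \<longleftrightarrow>
    (\<exists>k :: nat \<Rightarrow> real. filterlim k at_top sequentially \<and>
      (\<forall>n. torus_class (k n *\<^sub>R l) \<in> secular_set G bc) \<and>
      (\<lambda>n. torus_class (k n *\<^sub>R l)) \<longlonglongrightarrow> \<theta>)"
proof
  assume \<theta>: "\<theta> \<in> flow_closure l"
  obtain x where x: "\<theta> = torus_class x"
    using torus_class_surj by metis
  obtain N a where "open N" and "\<theta> \<in> N" and smooth: "torus_smooth_on N \<phi>" and "\<phi> \<theta> = 0"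
    and eig: "\<And>\<xi>. \<xi> \<in> N \<Longrightarrow> norm (a \<xi>) = 1 \<and>
      secular_unitary G bc \<xi> *v a \<xi> = cis (\<phi> \<xi>) *s a \<xi>"
    using assms(7) unfolding local_eigenphase_def by blast
  define W :: "(real ^ 'e) set" where "W = torus_class -` N"
  define g where "g y = \<phi> (torus_class y)" for y
  have W: "open W" "x \<in> W"
    using \<open>open N\<close> \<open>\<theta> \<in> N\<close> continuous_torus_class x
    by (auto simp: W_def continuous_on_open_vimage)
  have "continuous_on W g"
    using smooth unfolding torus_smooth_on_def W_def g_def[abs_def] by (metis Ck_on.simps(1))
  \<comment> \<open>Order 0 of smoothness gave continuity on \<open>W\<close>; order 1 gives
    differentiability of the lift at \<open>x\<close>.\<close>
  have "Ck_on (Suc 0) W g"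
    using smooth unfolding torus_smooth_on_def W_def g_def[abs_def] by blast
  then have "((\<lambda>t. g (x + t *\<^sub>R l)) has_real_derivative l \<bullet> torus_gradient \<phi> \<theta>) (at 0)"
    using torus_gradient_directional_deriv[of \<phi> x l] W(2) by (simp add: g_def[abs_def] x)
  note zeros = zero_on_nearby_flow_lines[OF W \<open>continuous_on W g\<close> _ this assms(8)]
  \<comment> \<open>The lift \<open>y\<close> is recorded along with the time \<open>k\<close>, so
    that convergence can be checked by distances in \<open>real ^ 'e\<close> and then pushed to the
    torus by continuity of \<open>torus_class\<close>.\<close>
  have "\<exists>k y. k \<ge> real n \<and> torus_class (k *\<^sub>R l) \<in> secular_set G bc \<and>
      torus_class (k *\<^sub>R l) = torus_class y \<and> dist y x < inverse (real (Suc n))" for n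
  proof -
    define \<epsilon> where "\<epsilon> = inverse (real (Suc n))"
    have "\<epsilon> > 0" "\<epsilon> \<le> 1"
      by (auto simp: \<epsilon>_def field_simps)
    obtain \<delta> where \<delta>: "\<delta> > 0" "\<And>y. dist y x < \<delta> \<Longrightarrow>
        \<exists>s. \<bar>s\<bar> \<le> \<epsilon> \<and> dist (y + s *\<^sub>R l) x < \<epsilon> \<and> y + s *\<^sub>R l \<in> W \<and> g (y + s *\<^sub>R l) = 0"
      using zeros[of \<epsilon>] \<open>\<epsilon> > 0\<close> \<open>\<phi> \<theta> = 0\<close> x by (auto simp: g_def)
    \<comment> \<open>The extra 1 pays for the later shift \<open>s\<close>, which may be negative
      but satisfies \<open>\<bar>s\<bar> \<le> \<epsilon> \<le> 1\<close>.\<close>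
    obtain k y where k: "k \<ge> real n + 1" "torus_class (k *\<^sub>R l) = torus_class y" "dist y x < \<delta>"
      using flow_closure_late_times[of x l \<delta> "real n + 1"] \<theta> x \<delta>(1) by auto
    obtain s where s: "\<bar>s\<bar> \<le> \<epsilon>" "dist (y + s *\<^sub>R l) x < \<epsilon>" "y + s *\<^sub>R l \<in> W" "g (y + s *\<^sub>R l) = 0"
      using \<delta>(2)[OF k(3)] by auto
    have eq: "torus_class ((k + s) *\<^sub>R l) = torus_class (y + s *\<^sub>R l)"
      using k(2) by (simp add: scaleR_left_distrib torus_class_add)
    \<comment> \<open>Where the eigenphase vanishes the eigenvalue is \<open>cis 0 = 1\<close>, so
      the unit vector \<open>a\<close> is a nonzero fixed vector.\<close>
    have "torus_class (y + s *\<^sub>R l) \<in> secular_set G bc"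
      using eig[of "torus_class (y + s *\<^sub>R l)"] s(3,4)
      by (intro secular_set_of_eigenvector[of _ _ _ "a (torus_class (y + s *\<^sub>R l))"])
        (auto simp: W_def g_def)
    moreover have "k + s \<ge> real n"
      using k(1) s(1) \<open>\<epsilon> \<le> 1\<close> by linarith
    ultimately show ?thesis
      using eq s(2) unfolding \<epsilon>_def by (metis (no_types))
  qed
  then obtain k y where k: "\<And>n. k n \<ge> real n"
    "\<And>n. torus_class (k n *\<^sub>R l) \<in> secular_set G bc"
    "\<And>n. torus_class (k n *\<^sub>R l) = torus_class (y n)"
    "\<And>n. dist (y n) x < inverse (real (Suc n))"
    by metis
  have "filterlim k at_top sequentially"
    by (rule filterlim_at_top_mono[OF filterlim_real_sequentially]) (use k(1) in auto)
  moreover have "y \<longlonglongrightarrow> x"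
    by (rule LIM_zero_cancel, rule LIMSEQ_norm_0)
      (use k(4) in \<open>simp add: dist_norm inverse_eq_divide\<close>)
  then have "(\<lambda>n. torus_class (y n)) \<longlonglongrightarrow> torus_class x"
    by (rule continuous_on_tendsto_compose[OF continuous_torus_class]) auto
  ultimately show "\<exists>k. filterlim k at_top sequentially \<and>
      (\<forall>n. torus_class (k n *\<^sub>R l) \<in> secular_set G bc) \<and> (\<lambda>n. torus_class (k n *\<^sub>R l)) \<longlonglongrightarrow> \<theta>"
    using k(2,3) x by (intro exI[of _ k]) simp
next
  assume "\<exists>k. filterlim k at_top sequentially \<and>
      (\<forall>n. torus_class (k n *\<^sub>R l) \<in> secular_set G bc) \<and> (\<lambda>n. torus_class (k n *\<^sub>R l)) \<longlonglongrightarrow> \<theta>"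
  then obtain k :: "nat \<Rightarrow> real" where "(\<lambda>n. torus_class (k n *\<^sub>R l)) \<longlonglongrightarrow> \<theta>"
    by blast
  \<comment> \<open>Conversely, every open neighbourhood of \<theta> contains a term of the
    sequence, which is a point of the orbit.\<close>
  then have "eventually (\<lambda>n. torus_class (k n *\<^sub>R l) \<in> V) sequentially" if "open V" "\<theta> \<in> V" for V
    using that by (rule topological_tendstoD)
  then have "\<exists>k. torus_class (k *\<^sub>R l) \<in> V" if "open V" "\<theta> \<in> V" for V
    using that eventually_happens'[OF sequentially_bot] by meson
  then show "\<theta> \<in> flow_closure l"
    unfolding flow_closure_def closure_iff_nhds_not_empty by blast
qed

end
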